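(* Let $n,M\ge1$, let $\mathcal{L}:\mathbb{R}^n\to\mathbb{R}_+$ be convex and positively homogeneous, and let $\dot x,v_1,\dots,v_M\in\mathbb{R}^n$. For any $\hat\lambda\in\Delta$ and any $j^\star\in\arg\max_j\hat\lambda_j$, $$\mathcal{L}(\dot x-v_{j^\star})\le\mathcal{L}\Big(\dot x-\sum_{j=1}^M\hat\lambda_jv_j\Big)+\sum_{j=1}^M\hat\lambda_j\,\mathcal{L}(v_j-v_{j^\star}).$$
   Context: $\Delta=\{\lambda\in\mathbb{R}^M:\lambda\ge0,\ \mathbf{1}^T\lambda=1\}$ is the probability simplex and $\mathbb{R}_+=[0,\infty)$. In the application $\dot x$ is a measured derivative at a state $x$ and $v_j=X_j(x)$ is the value at $x$ of the vector field of mode $j$. *)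

theory Defs
  imports "HOL-Analysis.Analysis"
begin

definition prob_simplex :: "(real ^ 'm) set"
  where "prob_simplex = {l. (\<forall>j. 0 \<le> l $ j) \<and> (\<Sum>j\<in>UNIV. l $ j) = 1}"

(* Scaling by t > 0 only, as is usual in convex analysis. For real-valued f this already gives
   f 0 = 0, so it agrees with the variant that also admits t = 0. *)
definition positively_homogeneous :: "('a::real_vector \<Rightarrow> real) \<Rightarrow> bool"
  where "positively_homogeneous f \<longleftrightarrow> (\<forall>t>0. \<forall>z. f (t *\<^sub>R z) = t * f z)"

end

theory Submission
  imports Defs
begin

text \<open>Convexity and positive homogeneity make \<open>L\<close> subadditive
  (\<open>sublinear_add_le\<close>). As the weights sum to 1, \<open>xdot - v jstar\<close> is the
  residual of the averaged field plus the \<open>lam\<close>-average of the differences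
  \<open>v j - v jstar\<close>. Subadditivity separates these two terms, and Jensen's inequality
  bounds \<open>L\<close> of the average by the average of \<open>L\<close>.\<close>

text \<open>By homogeneity the value at a sum is twice the value at the midpoint, where convexity
  applies.\<close>

lemma sublinear_add_le:
  fixes f :: "'a::real_vector \<Rightarrow> real"
  assumes "convex_on UNIV f" and "positively_homogeneous f"
  shows "f (x + y) \<le> f x + f y"
proof -
  have "f (x + y) = 2 * f ((1/2) *\<^sub>R x + (1/2) *\<^sub>R y)"
    using assms(2)[unfolded positively_homogeneous_def, rule_format, of "1/2" "x + y"]
    by (simp add: scaleR_add_right)
  also have "\<dots> \<le> 2 * ((1/2) * f x + (1/2) * f y)"
    using convex_onD[OF assms(1), of "1/2" x y] by simp
  finally show ?thesis by simp
qed

theorem proposition5: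
  fixes L :: "real ^ 'n \<Rightarrow> real"
    and xdot :: "real ^ 'n"
    and v :: "'m::finite \<Rightarrow> real ^ 'n"
    and lam :: "real ^ 'm"
    and jstar :: 'm
  assumes nonneg: "\<And>z. 0 \<le> L z"
    and convex: "convex_on UNIV L"
    and homogeneous: "positively_homogeneous L"
    and simplex: "lam \<in> prob_simplex"
    and argmax: "is_arg_max (\<lambda>j. lam $ j) (\<lambda>j. True) jstar"
  shows "L (xdot - v jstar)
       \<le> L (xdot - (\<Sum>j\<in>UNIV. (lam $ j) *\<^sub>R v j)) + (\<Sum>j\<in>UNIV. (lam $ j) * L (v j - v jstar))"
proof -
  let ?w = "\<Sum>j\<in>UNIV. (lam $ j) *\<^sub>R (v j - v jstar)"
  have lam: "\<And>j. 0 \<le> lam $ j" "(\<Sum>j\<in>UNIV. lam $ j) = 1"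
    using simplex by (auto simp: prob_simplex_def)
  \<comment> \<open>Total weight 1 lets the constant vector \<open>v jstar\<close> leave the average
    unscaled.\<close>
  have "?w = (\<Sum>j\<in>UNIV. (lam $ j) *\<^sub>R v j) - v jstar"
    by (simp add: scaleR_diff_right sum_subtractf lam(2) flip: scaleR_sum_left)
  then have "L (xdot - v jstar) = L ((xdot - (\<Sum>j\<in>UNIV. (lam $ j) *\<^sub>R v j)) + ?w)"
    by simp
  also have "\<dots> \<le> L (xdot - (\<Sum>j\<in>UNIV. (lam $ j) *\<^sub>R v j)) + L ?w"
    by (rule sublinear_add_le[OF convex homogeneous])
  \<comment> \<open>Jensen's inequality: \<open>?w\<close> is a convex combination with weights
    \<open>lam\<close>.\<close>
  also have "L ?w \<le> (\<Sum>j\<in>UNIV. (lam $ j) * L (v j - v jstar))"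
    by (rule convex_on_sum[OF _ _ convex]) (use lam in auto)
  finally show ?thesis by simp
qed

end
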